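(* Let $N\ge 2$, $\sigma>0$, $\alpha>0$, $\beta\ge 1$, and suppose $\mathrm{Null}(K_0)\cap\mathrm{Null}(\mathcal{T})=\{\mathbf 0\}$. Let $\{(u^k,v^k,p^k)\}_{k=0,1,2,\ldots}$ be a sequence generated by the nonconvex IADMM algorithm (defined in the context) with parameters $\alpha,\delta$. Assume that $$\delta>\max\left\{1,\ \frac{6\theta^2\|K\|_2^4}{\nu}+\frac{7\alpha^2\theta^2\|K\|_2^4}{\nu}\right\},\qquad \theta=\frac{1}{2\sin\left(\frac{\pi}{2N}\right)}.$$ Then any cluster point $(u^*,v^*,p^* )$ of $\{(u^k,v^k,p^k)\}$ is a critical point of $\mathcal{L}^{\varphi}_{\delta}$.
   Context: All norms $\|\cdot\|$ of vectors are Euclidean; $\|A\|_2=\max_{\|x\|=1}\|Ax\|$; $A^*$ is the adjoint; $\lambda_{\min}$ is the smallest eigenvalue; $\mathrm{Null}(A)=\{x: Ax=\mathbf 0\}$; $\otimes$ is the Kronecker product. Data. $\tilde K\in\mathbb{R}^{N^2\times N^2}$ is a matrix (blurring operator), $\tilde f\in\mathbb{R}^{N^2}$. $D\in\mathbb{R}^{(N-1)\times N}$ is the matrix with $D_{i,i}=1$, $D_{i,i+1}=-1$, other entries $0$. $\mathbb I$ and $I_N$ are identity matrices. Define $$\mathcal{T}=\begin{pmatrix} I_N\otimes D & \mathbf 0\\ \mathbf 0& D\otimes I_N\end{pmatrix}\in\mathbb{R}^{2N(N-1)\times 2N^2},\quad K=\begin{pmatrix}\tilde K&\mathbf 0\\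 \beta\mathbb I&-\beta\mathbb I\end{pmatrix},\quad K_0=\begin{pmatrix}\tilde K&\mathbf 0\\ \mathbb I&-\mathbb I\end{pmatrix},\quad f=\begin{pmatrix}\tilde f\\ \mathbf 0\end{pmatrix}.$$ $\nu=\lambda_{\min}(K_0^*K_0+\mathcal{T}^*\mathcal{T})>0$. $\varphi:\mathbb{R}\to\mathbb{R}$ is a nonconvex, possibly nondifferentiable, lower semicontinuous regularization function, and $\|v\|_\varphi=\sum_i\varphi(v_i)$ for $v\in\mathbb{R}^{2N(N-1)}$. For $u\in\mathbb{R}^{2N^2}$, $v,p\in\mathbb{R}^{2N(N-1)}$, $$\mathcal{L}_{\delta}^{\varphi}(u,v,p)=\tfrac12\|Ku-f\|^2+\sigma\|v\|_\varphi-\langle p,\mathcal{T}u-v\rangle+\tfrac{\delta}{2}\|\mathcal{T}u-v\|^2.$$ Nonconvex IADMM algorithm with parameters $\alpha,\delta>0$: initial points $u^0=u^1$, $v^0=v^1$, $p^0=p^1$ are arbitrary; for $k=1,2,\ldots$ $$(\widehat u^k,\widehat v^k,\widehat p^k)=(u^k,v^k,p^k)+\alpha(u^k-u^{k-1},v^k-v^{k-1},p^k-p^{k-1}),$$ $$v^{k+1}\in\arg\min_v\mathcal{L}_{\delta}^{\varphi}(u^k,v,\widehat p^k),\quad u^{k+1}=\arg\min_u\mathcal{L}_{\delta}^{\varphi}(u,v^{k+1},\widehat p^k),\quad p^{k+1}=\widehat p^k-\delta(\mathcal{T}u^{k+1}-v^{k+1}).$$ (Equivalently $u^{k+1}=(K^*K+\delta\mathcal{T}^*\mathcal{T})^{-1}(K^*f+\delta\mathcal{T}^*v^{k+1}+\mathcal{T}^*\widehat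 p^k)$.) Subdifferential: for proper lower semicontinuous $J$, $\partial J(x)$ is the set of $\xi$ for which there are $x^k\to x$, $\xi^k\to\xi$ with $\liminf_{y\to x^k,\,y\ne x^k}\frac{J(y)-J(x^k)-\langle\xi^k,y-x^k\rangle}{\|y-x^k\|}\ge0$. A critical point of $J$ is a point $x$ with $\mathbf 0\in\partial J(x)$. *)

theory Defs
  imports "HOL-Analysis.Analysis"
begin

section \<open>Matrices\<close>

text \<open>
  A block vector or block matrix is indexed by a sum type, and a Kronecker product by a product
  type (block index first, index inside the block second).
\<close>

definition block_vec :: "real^'a \<Rightarrow> real^'b \<Rightarrow> real^('a + 'b)" where
  "block_vec x y = (\<chi> i. case i of Inl a \<Rightarrow> x $ a | Inr b \<Rightarrow> y $ b)"

definition block_matrix ::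
  "real^'c^'a \<Rightarrow> real^'d^'a \<Rightarrow> real^'c^'b \<Rightarrow> real^'d^'b \<Rightarrow> real^('c + 'd)^('a + 'b)" where
  "block_matrix A B C D = (\<chi> i j.
     case i of
       Inl a \<Rightarrow> (case j of Inl c \<Rightarrow> A $ a $ c | Inr d \<Rightarrow> B $ a $ d)
     | Inr b \<Rightarrow> (case j of Inl c \<Rightarrow> C $ b $ c | Inr d \<Rightarrow> D $ b $ d))"

definition kronecker :: "real^'b^'a \<Rightarrow> real^'d^'c \<Rightarrow> real^('b \<times> 'd)^('a \<times> 'c)" where
  "kronecker A B = (\<chi> i j. A $ fst i $ fst j * B $ snd i $ snd j)"

definition null_space :: "real^'n^'m \<Rightarrow> (real^'n) set" where
  "null_space A = {x. A *v x = 0}"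

definition eigenvalues :: "real^'n^'n \<Rightarrow> real set" where
  "eigenvalues A = {c. \<exists>x. x \<noteq> 0 \<and> A *v x = c *\<^sub>R x}"

text \<open>Only applied to symmetric matrices, whose set of real eigenvalues is finite and nonempty.\<close>

definition lambda_min :: "real^'n^'n \<Rightarrow> real" where
  "lambda_min A = Min (eigenvalues A)"

text \<open>
  The 1-based position of an index in the order of its type, so that matrices whose entries
  depend on row and column numbers can be written down over index types.
\<close>

definition pos :: "'a::{finite,linorder} \<Rightarrow> nat" where
  "pos i = card {j. j \<le> i}"

text \<open>
  The difference matrix; it is meant for \<open>CARD('n) = N\<close> columns and \<open>CARD('m) = N - 1\<close> rows.
\<close>

definition diff_matrix :: "real^'n::{finite,linorder}^'m::{finite,linorder}" where
  "diff_matrix = (\<chi> i j. if pos j = pos i then 1 else if pos j = pos i + 1 then - 1 else 0)"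

definition TV_matrix ::
  "real^('n::{finite,linorder} \<times> 'n + 'n \<times> 'n)^('n \<times> 'm::{finite,linorder} + 'm \<times> 'n)" where
  "TV_matrix = block_matrix (kronecker (mat 1) diff_matrix) 0 0 (kronecker diff_matrix (mat 1))"

definition K_matrix :: "real \<Rightarrow> real^'s^'s \<Rightarrow> real^('s + 's)^('s + 's)" where
  "K_matrix \<beta> Kt = block_matrix Kt 0 (\<beta> *\<^sub>R mat 1) (- (\<beta> *\<^sub>R mat 1))"

definition K0_matrix :: "real^'s^'s \<Rightarrow> real^('s + 's)^('s + 's)" where
  "K0_matrix Kt = block_matrix Kt 0 (mat 1) (- mat 1)"

section \<open>Variational notions\<close>

definition lower_semicontinuous :: "('a::topological_space \<Rightarrow> real) \<Rightarrow> bool" where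
  "lower_semicontinuous J \<longleftrightarrow> (\<forall>x. ereal (J x) \<le> Liminf (at x) (\<lambda>y. ereal (J y)))"

text \<open>
  Limits of regular subgradients along \<open>X k \<longlonglongrightarrow> x\<close>, without the requirement
  \<open>J (X k) \<longlonglongrightarrow> J x\<close> that some authors add. A real-valued function is proper.
\<close>

definition subdifferential :: "('a::real_inner \<Rightarrow> real) \<Rightarrow> 'a \<Rightarrow> 'a set" where
  "subdifferential J x = {\<xi>. \<exists>X \<Xi>. X \<longlonglongrightarrow> x \<and> \<Xi> \<longlonglongrightarrow> \<xi> \<and>
     (\<forall>k::nat. 0 \<le> Liminf (at (X k))
        (\<lambda>y. ereal ((J y - J (X k) - \<Xi> k \<bullet> (y - X k)) / norm (y - X k))))}"

definition critical_point :: "('a::real_inner \<Rightarrow> real) \<Rightarrow> 'a \<Rightarrow> bool" where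
  "critical_point J x \<longleftrightarrow> 0 \<in> subdifferential J x"

definition cluster_point :: "(nat \<Rightarrow> 'a::topological_space) \<Rightarrow> 'a \<Rightarrow> bool" where
  "cluster_point X x \<longleftrightarrow> (\<exists>r. strict_mono r \<and> (X \<circ> r) \<longlonglongrightarrow> x)"

section \<open>The inertial ADMM\<close>

definition reg :: "(real \<Rightarrow> real) \<Rightarrow> real^'i \<Rightarrow> real" where
  "reg \<phi> v = (\<Sum>i\<in>UNIV. \<phi> (v $ i))"

definition aug_lagrangian ::
  "real^'c^'r \<Rightarrow> real^'r \<Rightarrow> real^'c^'d \<Rightarrow> (real \<Rightarrow> real) \<Rightarrow> real \<Rightarrow> real
     \<Rightarrow> real^'c \<Rightarrow> real^'d \<Rightarrow> real^'d \<Rightarrow> real" where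
  "aug_lagrangian K f T \<phi> \<sigma> \<delta> u v p =
     1 / 2 * (norm (K *v u - f))\<^sup>2 + \<sigma> * reg \<phi> v - p \<bullet> (T *v u - v)
       + \<delta> / 2 * (norm (T *v u - v))\<^sup>2"

text \<open>
  The extrapolated \<open>u\<close> and \<open>v\<close> are never used by the updates, so only the extrapolated
  multiplier \<open>ph\<close> appears.
\<close>

definition IADMM_sequence ::
  "real^'c^'r \<Rightarrow> real^'r \<Rightarrow> real^'c^'d \<Rightarrow> (real \<Rightarrow> real) \<Rightarrow> real \<Rightarrow> real \<Rightarrow> real
     \<Rightarrow> (nat \<Rightarrow> real^'c) \<Rightarrow> (nat \<Rightarrow> real^'d) \<Rightarrow> (nat \<Rightarrow> real^'d) \<Rightarrow> bool" where
  "IADMM_sequence K f T \<phi> \<sigma> \<alpha> \<delta> u v p \<longleftrightarrow>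
     u 0 = u 1 \<and> v 0 = v 1 \<and> p 0 = p 1 \<and>
     (\<forall>k\<ge>1. let ph = p k + \<alpha> *\<^sub>R (p k - p (k - 1)) in
        is_arg_min (\<lambda>v'. aug_lagrangian K f T \<phi> \<sigma> \<delta> (u k) v' ph) (\<lambda>_. True) (v (k + 1)) \<and>
        is_arg_min (\<lambda>u'. aug_lagrangian K f T \<phi> \<sigma> \<delta> u' (v (k + 1)) ph) (\<lambda>_. True) (u (k + 1)) \<and>
        p (k + 1) = ph - \<delta> *\<^sub>R (T *v u (k + 1) - v (k + 1)))"

end

theory Submission
  imports Defs
begin

text \<open>
  The proof is the usual analysis of a nonconvex ADMM: a Lyapunov function shows that consecutive
  iterates approach each other, and the optimality conditions of the updates then pass to the limit.

  Write \<open>q\<close> for the increments of the multipliers. Three facts carry the descent. The matrix \<open>T\<close>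
  consists of blocks built from the difference matrix, whose adjoint is bounded below by
  \<open>2 sin (\<pi> / (2 N)) = 1 / \<theta>\<close> (\<open>discrete_Wirtinger\<close>, \<open>TV_matrix_adjoint_bound\<close>). Optimality of the
  \<open>u\<close> update, combined with the multiplier update, reads \<open>T\<^sup>* p = K\<^sup>* (K u - f)\<close>, so increments of
  \<open>p\<close> are at most \<open>\<theta> \<parallel>K\<parallel>\<^sup>2\<close> times increments of \<open>u\<close> (\<open>multiplier_increment_bound\<close>). And the
  \<open>u\<close> update decreases the Lagrangian by at least \<open>\<nu> / 2\<close> times the squared increment of \<open>u\<close>, since
  \<open>\<nu>\<close> is the smallest eigenvalue of \<open>K\<^sub>0\<^sup>* K\<^sub>0 + T\<^sup>* T\<close> (\<open>lambda_min_normal_sum\<close>) and \<open>\<beta>, \<delta> \<ge> 1\<close>.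

  Updating and extrapolating the multiplier may increase the Lagrangian, by quantities quadratic in
  the last three increments \<open>q\<close> and divided by \<open>\<delta>\<close> (\<open>descent\<close>). Expressed by increments of \<open>u\<close>
  their total weight is \<open>(5 + 7 \<alpha>\<^sup>2) \<theta>\<^sup>2 \<parallel>K\<parallel>\<^sup>4 / (2 \<delta>) < \<nu> / 2\<close>, so the Lagrangian plus the losses
  still to come decreases. Near a cluster point the Lagrangian is bounded below, because \<open>\<phi>\<close> is
  lower semicontinuous and \<open>\<sigma>\<close> is positive; a decreasing sequence bounded along a subsequence is
  bounded, and hence all increments and the constraint residual \<open>T u - v\<close> tend to zero
  (\<open>increments_tendsto_zero\<close>).

  Finally, \<open>v\<^sup>k\<^sup>+\<^sup>1\<close> minimises the Lagrangian at \<open>u\<^sup>k\<close> and the extrapolated multiplier, and in the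
  other two arguments the Lagrangian is smooth. This gives an explicit regular subgradient at that
  point (\<open>aug_lagrangian_regular_subgradient\<close>) whose components are increments and residuals. Along
  the subsequence both the points and the subgradients converge, the latter to zero.
\<close>

section \<open>The smallest eigenvalue of a symmetric matrix\<close>

lemma quadratic_nonneg_imp_linear_coeff_zero:
  fixes b c :: real
  assumes "\<And>t. 0 \<le> t * b + t\<^sup>2 * c"
  shows "b = 0"
proof (rule ccontr)
  assume "b \<noteq> 0"
  define m where "m = \<bar>c\<bar> + 1"
  have m: "m > 0" "c < m" by (auto simp: m_def)
  have "0 \<le> (- b / m) * b + (- b / m)\<^sup>2 * c" by (rule assms)
  also have "\<dots> = (b\<^sup>2 / m\<^sup>2) * (c - m)"
    using m by (simp add: field_simps power2_eq_square)
  also have "\<dots> < 0"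
    using m \<open>b \<noteq> 0\<close> by (intro mult_pos_neg) auto
  finally show False by simp
qed

lemma inner_transpose_mult_left:
  fixes A :: "real^'n^'m"
  shows "(transpose A *v x) \<bullet> y = x \<bullet> (A *v y)"
  by (simp add: transpose_matrix_vector dot_lmul_matrix)

lemma inner_transpose_mult_right:
  fixes A :: "real^'n^'m"
  shows "y \<bullet> (transpose A *v x) = (A *v y) \<bullet> x"
  by (metis inner_commute inner_transpose_mult_left)

text \<open>
  Eigenvectors of different eigenvalues are orthogonal, so one eigenvector for each eigenvalue
  gives an orthogonal family, which is finite. Without this the minimum that defines
  \<open>lambda_min\<close> would be unspecified.
\<close>

lemma finite_eigenvalues_symmetric:
  fixes A :: "real^'n^'n"
  assumes sym: "transpose A = A"
  shows "finite (eigenvalues A)"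
proof -
  have "\<forall>c\<in>eigenvalues A. \<exists>x. x \<noteq> 0 \<and> A *v x = c *\<^sub>R x"
    by (auto simp: eigenvalues_def)
  then obtain e where e: "\<And>c. c \<in> eigenvalues A \<Longrightarrow> e c \<noteq> 0 \<and> A *v e c = c *\<^sub>R e c"
    by metis
  have orth: "e c \<bullet> e d = 0" if "c \<in> eigenvalues A" "d \<in> eigenvalues A" "c \<noteq> d" for c d
  proof -
    have "c * (e c \<bullet> e d) = (A *v e c) \<bullet> e d" using e[OF that(1)] by simp
    also have "\<dots> = e c \<bullet> (A *v e d)"
      using inner_transpose_mult_left[of A "e c" "e d"] sym by simp
    also have "\<dots> = d * (e c \<bullet> e d)" using e[OF that(2)] by simp
    finally show ?thesis using that(3) by simp
  qed
  have "inj_on e (eigenvalues A)"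
    by (rule inj_onI) (metis e inner_eq_zero_iff orth)
  moreover have "finite (e ` eigenvalues A)"
    by (rule pairwise_orthogonal_imp_finite)
      (auto simp: pairwise_def orthogonal_def intro: orth)
  ultimately show ?thesis by (metis finite_imageD)
qed

text \<open>
  The quadratic form attains its minimum \<open>\<mu>\<close> over the unit sphere at some \<open>x0\<close>; the form shifted
  by \<open>\<mu>\<close> is then nonnegative everywhere and vanishes at \<open>x0\<close>, so its derivative vanishes there,
  which says that \<open>x0\<close> is an eigenvector.
\<close>

lemma exists_eigenvalue_le_Rayleigh:
  fixes A :: "real^'n^'n"
  assumes sym: "transpose A = A"
  shows "\<exists>\<mu>\<in>eigenvalues A. \<forall>x. \<mu> * (norm x)\<^sup>2 \<le> x \<bullet> (A *v x)"
proof -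
  have "continuous_on (sphere 0 1) (\<lambda>x. x \<bullet> (A *v x))"
    by (intro continuous_intros matrix_vector_mult_linear_continuous_on)
  moreover have "sphere (0::real^'n) 1 \<noteq> {}" by simp
  ultimately obtain x0 where x0: "norm x0 = 1"
    and min: "\<And>x. norm x = 1 \<Longrightarrow> x0 \<bullet> (A *v x0) \<le> x \<bullet> (A *v x)"
    using continuous_attains_inf[OF compact_sphere[of "0::real^'n" 1]]
    by (auto simp: sphere_def dist_norm)
  define \<mu> where "\<mu> = x0 \<bullet> (A *v x0)"
  have ray: "\<mu> * (norm x)\<^sup>2 \<le> x \<bullet> (A *v x)" for x
  proof (cases "x = 0")
    case False
    have "\<mu> \<le> (x /\<^sub>R norm x) \<bullet> (A *v (x /\<^sub>R norm x))"
      unfolding \<mu>_def by (rule min) (use False in simp)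
    also have "\<dots> = (x \<bullet> (A *v x)) / (norm x)\<^sup>2"
      by (simp add: matrix_vector_mult_scaleR power2_eq_square field_simps)
    finally show ?thesis using False by (simp add: field_simps)
  qed simp
  have "d \<bullet> (A *v x0 - \<mu> *\<^sub>R x0) = 0" for d
  proof -
    have "0 \<le> t * (2 * (d \<bullet> (A *v x0 - \<mu> *\<^sub>R x0))) + t\<^sup>2 * (d \<bullet> (A *v d) - \<mu> * (d \<bullet> d))" for t
    proof -
      have "x0 \<bullet> (A *v d) = d \<bullet> (A *v x0)"
        using inner_transpose_mult_left[of A x0 d] sym by (simp add: inner_commute)
      moreover have "\<mu> * ((x0 + t *\<^sub>R d) \<bullet> (x0 + t *\<^sub>R d))
          \<le> (x0 + t *\<^sub>R d) \<bullet> (A *v (x0 + t *\<^sub>R d))"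
        using ray[of "x0 + t *\<^sub>R d"] by (simp add: power2_norm_eq_inner)
      moreover have "x0 \<bullet> x0 = 1" using x0 by (simp add: norm_eq_1)
      ultimately show ?thesis
        by (simp add: \<mu>_def[symmetric] matrix_vector_mult_scaleR matrix_vector_right_distrib inner_commute
          inner_add_left inner_add_right inner_diff_right algebra_simps power2_eq_square)
    qed
    from quadratic_nonneg_imp_linear_coeff_zero[OF this] show ?thesis by simp
  qed
  from this[of "A *v x0 - \<mu> *\<^sub>R x0"] have "A *v x0 = \<mu> *\<^sub>R x0" by simp
  moreover have "x0 \<noteq> 0" using x0 by auto
  ultimately have "\<mu> \<in> eigenvalues A" by (auto simp: eigenvalues_def)
  with ray show ?thesis by blast
qed

lemma lambda_min_symmetric:
  fixes A :: "real^'n^'n"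
  assumes sym: "transpose A = A"
  shows "lambda_min A \<in> eigenvalues A"
    and "lambda_min A * (norm x)\<^sup>2 \<le> x \<bullet> (A *v x)"
proof -
  obtain \<mu> where \<mu>: "\<mu> \<in> eigenvalues A" "\<And>x. \<mu> * (norm x)\<^sup>2 \<le> x \<bullet> (A *v x)"
    using exists_eigenvalue_le_Rayleigh[OF sym] by blast
  note fin = finite_eigenvalues_symmetric[OF sym]
  show "lambda_min A \<in> eigenvalues A"
    unfolding lambda_min_def using fin \<mu>(1) by (intro Min_in) auto
  have "lambda_min A \<le> \<mu>"
    unfolding lambda_min_def using fin \<mu>(1) by simp
  then have "lambda_min A * (norm x)\<^sup>2 \<le> \<mu> * (norm x)\<^sup>2"
    by (rule mult_right_mono) simp
  with \<mu>(2)[of x] show "lambda_min A * (norm x)\<^sup>2 \<le> x \<bullet> (A *v x)" by linarith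
qed

text \<open>
  The eigenvalue is the value of \<open>\<parallel>A x\<parallel>\<^sup>2 + \<parallel>B x\<parallel>\<^sup>2\<close> at a unit eigenvector, which lies in at most one
  of the two null spaces.
\<close>

lemma lambda_min_normal_sum:
  fixes A :: "real^'n^'m" and B :: "real^'n^'k"
  assumes null: "null_space A \<inter> null_space B = {0}"
  defines "M \<equiv> transpose A ** A + transpose B ** B"
  shows "0 < lambda_min M"
    and "lambda_min M * (norm x)\<^sup>2 \<le> (norm (A *v x))\<^sup>2 + (norm (B *v x))\<^sup>2"
proof -
  have tadd: "transpose (P + Q) = transpose P + transpose Q" for P Q :: "real^'n^'n"
    by (simp add: transpose_def vec_eq_iff)
  have sym: "transpose M = M"
    by (simp add: M_def tadd matrix_transpose_mul)
  have quad: "x \<bullet> (M *v x) = (norm (A *v x))\<^sup>2 + (norm (B *v x))\<^sup>2" for x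
    unfolding M_def matrix_vector_mult_add_rdistrib inner_add_right matrix_vector_mul_assoc[symmetric]
      inner_transpose_mult_right power2_norm_eq_inner ..
  show "lambda_min M * (norm x)\<^sup>2 \<le> (norm (A *v x))\<^sup>2 + (norm (B *v x))\<^sup>2"
    using lambda_min_symmetric(2)[OF sym, of x] by (simp add: quad)
  obtain e where e: "e \<noteq> 0" "M *v e = lambda_min M *\<^sub>R e"
    using lambda_min_symmetric(1)[OF sym] by (auto simp: eigenvalues_def)
  have "e \<notin> null_space A \<inter> null_space B" using e(1) null by blast
  then have "0 < (norm (A *v e))\<^sup>2 + (norm (B *v e))\<^sup>2"
    by (auto simp: null_space_def sum_power2_gt_zero_iff)
  also have "\<dots> = lambda_min M * (norm e)\<^sup>2"
    using quad[of e] e(2) by (simp add: power2_norm_eq_inner)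
  finally show "0 < lambda_min M"
    using zero_less_mult_pos2[of "lambda_min M" "(norm e)\<^sup>2"] e(1) by simp
qed

section \<open>The smallest singular value of the difference matrices\<close>

text \<open>
  The constant is the smallest eigenvalue of the second difference with zero boundary values, and
  \<open>s i = sin (i \<pi> / n)\<close> is its eigenvector, positive in the interior. Positivity allows Picone's
  argument: completing the square with weights \<open>s (i + 1) / s i\<close> bounds each squared difference
  from below by a combination of \<open>(y i)\<^sup>2\<close> and \<open>(y (i + 1))\<^sup>2\<close>, and the sum of the coefficients
  belonging to one \<open>i\<close> is \<open>2 - (s (i - 1) + s (i + 1)) / s i = 2 - 2 cos (\<pi> / n)\<close>.
\<close>

lemma discrete_Wirtinger:
  fixes y :: "nat \<Rightarrow> real" and n :: nat
  assumes n: "n \<ge> 1" and y0: "y 0 = 0" and yn: "y n = 0"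
  shows "(2 * sin (pi / (2 * real n)))\<^sup>2 * (\<Sum>i=1..<n. (y i)\<^sup>2)
    \<le> (\<Sum>i<n. (y (Suc i) - y i)\<^sup>2)"
proof -
  define s where "s i = sin (real i * (pi / real n))" for i
  have spos: "s i > 0" if "i \<ge> 1" "i < n" for i
    unfolding s_def
  proof (rule sin_gt_zero)
    show "0 < real i * (pi / real n)" using that by simp
    have "real i * (pi / real n) < real n * (pi / real n)"
      using that by (intro mult_strict_right_mono) auto
    then show "real i * (pi / real n) < pi" using that by simp
  qed
  have s0: "s 0 = 0" by (simp add: s_def)
  \<comment> \<open>What the difference to the left and the difference to the right of \<open>i\<close> contribute to the coefficient of \<open>(y i)\<^sup>2\<close>.\<close>
  define l r where "l i = (y i)\<^sup>2 * (1 - s (i - 1) / s i)"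
    and "r i = (y i)\<^sup>2 * (1 - s (Suc i) / s i)" for i
  have step: "l (Suc i) + r i \<le> (y (Suc i) - y i)\<^sup>2" if i: "i < n" for i
  proof -
    consider "i = 0" | "Suc i = n" | "i \<ge> 1" "Suc i < n" using i by linarith
    then show ?thesis
    proof cases
      \<comment> \<open>Here \<open>s i = 0\<close>, and the junk value of \<open>s (i + 1) / s i\<close> is multiplied by \<open>y 0 = 0\<close>.\<close>
      case 1
      then show ?thesis by (simp add: l_def r_def y0 s0)
    next
      case 2
      then have "s (Suc i) = 0" using n by (simp add: s_def)
      then show ?thesis using 2 yn by (simp add: l_def r_def)
    next
      case 3
      then have a: "s i > 0" "s (Suc i) > 0" by (auto intro: spos)
      have "(y (Suc i) - y i)\<^sup>2 - (l (Suc i) + r i)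
          = s i * s (Suc i) * (y (Suc i) / s (Suc i) - y i / s i)\<^sup>2"
        using a by (simp add: l_def r_def field_simps power2_eq_square)
      also have "\<dots> \<ge> 0" using a by simp
      finally show ?thesis by simp
    qed
  qed
  have lr: "l i + r i = (2 * sin (pi / (2 * real n)))\<^sup>2 * (y i)\<^sup>2" if "i \<in> {1..<n}" for i
  proof -
    have i: "i \<ge> 1" "s i > 0" using that spos by auto
    define t where "t = pi / real n"
    have "s (i - 1) + s (Suc i) = sin (real i * t - t) + sin (real i * t + t)"
      unfolding s_def t_def[symmetric] using i
      by (simp add: of_nat_diff left_diff_distrib distrib_right add.commute)
    also have "\<dots> = 2 * cos t * s i"
      by (simp add: sin_add sin_diff s_def t_def)
    finally have ss: "s (i - 1) / s i + s (Suc i) / s i = 2 * cos t"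
      using i by (simp add: field_simps)
    have "l i + r i = (y i)\<^sup>2 * (2 - (s (i - 1) / s i + s (Suc i) / s i))"
      by (simp add: l_def r_def algebra_simps)
    also have "\<dots> = (y i)\<^sup>2 * (2 - 2 * cos (2 * (t / 2)))"
      unfolding ss by simp
    also have "\<dots> = (y i)\<^sup>2 * (2 * sin (t / 2))\<^sup>2"
      unfolding cos_double_sin by (simp add: power2_eq_square)
    finally show ?thesis by (simp add: t_def mult.commute)
  qed
  have "(2 * sin (pi / (2 * real n)))\<^sup>2 * (\<Sum>i=1..<n. (y i)\<^sup>2) = (\<Sum>i=1..<n. l i + r i)"
    by (simp add: lr sum_distrib_left)
  also have "\<dots> = (\<Sum>i=1..<n. l i) + (\<Sum>i=1..<n. r i)"
    by (rule sum.distrib)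
  also have "(\<Sum>i=1..<n. l i) = (\<Sum>i=1..<Suc n. l i)"
    using n by (simp add: l_def yn)
  also have "\<dots> = (\<Sum>i<n. l (Suc i))"
    by (simp only: One_nat_def sum.shift_bounds_Suc_ivl atLeast0LessThan)
  also have "(\<Sum>i=1..<n. r i) = (\<Sum>i<n. r i)"
    by (rule sum.mono_neutral_left) (auto simp: r_def y0 Suc_le_eq intro!: gr0I)
  also have "(\<Sum>i<n. l (Suc i)) + (\<Sum>i<n. r i) = (\<Sum>i<n. l (Suc i) + r i)"
    by (rule sum.distrib[symmetric])
  also have "\<dots> \<le> (\<Sum>i<n. (y (Suc i) - y i)\<^sup>2)"
    by (rule sum_mono) (simp add: step)
  finally show ?thesis .
qed

lemma pos_bij: "bij_betw (pos :: 'a::{finite,linorder} \<Rightarrow> nat) UNIV {1..CARD('a)}"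
proof -
  have "pos i < pos j" if "i < j" for i j :: 'a
    unfolding pos_def atMost_def[symmetric] using that
    by (intro psubset_card_mono) (auto simp: psubset_eq)
  then have inj: "inj (pos :: 'a \<Rightarrow> nat)"
    by (metis injI linorder_less_linear order_less_irrefl)
  have "pos (i::'a) \<ge> 1" "pos i \<le> CARD('a)" for i
    unfolding pos_def by (auto simp: Suc_le_eq card_gt_0_iff intro: card_mono)
  then have "range (pos :: 'a \<Rightarrow> nat) \<subseteq> {1..CARD('a)}" by auto
  moreover have "card (range (pos :: 'a \<Rightarrow> nat)) = card {1..CARD('a)}"
    using inj by (simp add: card_image)
  ultimately have "range (pos :: 'a \<Rightarrow> nat) = {1..CARD('a)}"
    by (intro card_subset_eq) auto
  with inj show ?thesis by (simp add: bij_betw_def)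
qed

text \<open>
  Read \<open>x\<close> as a sequence \<open>y\<close> over positions and continue it by zero: column \<open>j\<close> of the difference
  matrix has a \<open>1\<close> in the row at the position of \<open>j\<close> and a \<open>- 1\<close> in the row just before, so the
  adjoint takes differences of \<open>y\<close>, whose zero values at both ends are what the Wirtinger
  inequality asks for.
\<close>

lemma diff_matrix_adjoint_bound:
  fixes D :: "real^'n::{finite,linorder}^'m::{finite,linorder}" and x :: "'m \<Rightarrow> real"
  assumes D: "D = diff_matrix" and card: "CARD('n) = CARD('m) + 1"
  shows "(2 * sin (pi / (2 * real CARD('n))))\<^sup>2 * (\<Sum>i\<in>UNIV. (x i)\<^sup>2)
    \<le> (\<Sum>j\<in>UNIV. (\<Sum>i\<in>UNIV. D $ i $ j * x i)\<^sup>2)"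
proof -
  define y where "y k = (\<Sum>i\<in>UNIV. if pos i = k then x i else 0)" for k
  have inj: "inj (pos :: 'm \<Rightarrow> nat)" by (rule bij_betw_imp_inj_on[OF pos_bij])
  have range_m: "range (pos :: 'm \<Rightarrow> nat) = {1..CARD('m)}"
    and range_n: "range (pos :: 'n \<Rightarrow> nat) = {1..CARD('n)}"
    by (rule bij_betw_imp_surj_on[OF pos_bij])+
  have ypos: "y (pos i) = x i" for i
  proof -
    have "y (pos i) = (\<Sum>i'\<in>UNIV. if i' = i then x i' else 0)"
      unfolding y_def by (rule sum.cong) (simp_all add: inj_eq[OF inj])
    then show ?thesis by simp
  qed
  have yout: "y k = 0" if "k \<notin> {1..CARD('m)}" for k
    unfolding y_def using that range_m by (intro sum.neutral) auto
  have col: "(\<Sum>i\<in>UNIV. D $ i $ j * x i) = y (pos j) - y (pos j - 1)" for j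
  proof -
    have "pos j \<ge> 1" using range_n by (metis UNIV_I atLeastAtMost_iff image_eqI)
    then have "pos j = pos i + 1 \<longleftrightarrow> pos i = pos j - 1" for i :: 'm by auto
    then have "D $ i $ j * x i
        = (if pos i = pos j then x i else 0) - (if pos i = pos j - 1 then x i else 0)" for i
      using \<open>pos j \<ge> 1\<close> by (auto simp: D diff_matrix_def)
    then show ?thesis by (simp add: y_def sum_subtractf)
  qed
  have "(\<Sum>i\<in>UNIV. (x i)\<^sup>2) = (\<Sum>k\<in>{1..CARD('m)}. (y k)\<^sup>2)"
    using sum.reindex_bij_betw[OF pos_bij[where 'a='m], of "\<lambda>k. (y k)\<^sup>2"] by (simp add: ypos)
  also have "{1..CARD('m)} = {1..<CARD('n)}" using card by auto
  finally have lhs: "(\<Sum>i\<in>UNIV. (x i)\<^sup>2) = (\<Sum>k=1..<CARD('n). (y k)\<^sup>2)" .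
  have "(\<Sum>j\<in>UNIV. (\<Sum>i\<in>UNIV. D $ i $ j * x i)\<^sup>2)
      = (\<Sum>k\<in>{1..CARD('n)}. (y k - y (k - 1))\<^sup>2)"
    using sum.reindex_bij_betw[OF pos_bij[where 'a='n], of "\<lambda>k. (y k - y (k - 1))\<^sup>2"]
    by (simp add: col)
  also have "{1..CARD('n)} = {1..<Suc CARD('n)}" by auto
  also have "(\<Sum>k\<in>{1..<Suc CARD('n)}. (y k - y (k - 1))\<^sup>2) = (\<Sum>i<CARD('n). (y (Suc i) - y i)\<^sup>2)"
    by (simp only: One_nat_def sum.shift_bounds_Suc_ivl atLeast0LessThan diff_Suc_Suc diff_zero)
  finally have rhs: "(\<Sum>j\<in>UNIV. (\<Sum>i\<in>UNIV. D $ i $ j * x i)\<^sup>2)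
      = (\<Sum>i<CARD('n). (y (Suc i) - y i)\<^sup>2)" .
  show ?thesis
    unfolding lhs rhs by (rule discrete_Wirtinger) (use card in \<open>auto intro: yout\<close>)
qed

lemma power2_norm_vec: "(norm (x :: real^'n))\<^sup>2 = (\<Sum>i\<in>UNIV. (x $ i)\<^sup>2)"
  unfolding power2_norm_eq_inner by (simp add: inner_vec_def power2_eq_square)

lemma sum_UNIV_Plus:
  fixes g :: "'a::finite + 'b::finite \<Rightarrow> 'c::comm_monoid_add"
  shows "(\<Sum>i\<in>UNIV. g i) = (\<Sum>a\<in>UNIV. g (Inl a)) + (\<Sum>b\<in>UNIV. g (Inr b))"
  unfolding UNIV_Plus_UNIV[symmetric] by (subst sum.Plus) auto

lemma sum_UNIV_Times:
  fixes g :: "'a::finite \<times> 'b::finite \<Rightarrow> 'c::comm_monoid_add"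
  shows "(\<Sum>i\<in>UNIV. g i) = (\<Sum>a\<in>UNIV. \<Sum>b\<in>UNIV. g (a, b))"
  unfolding UNIV_Times_UNIV[symmetric] by (simp add: sum.cartesian_product)

text \<open>
  The adjoint acts on each row of the first component and on each column of the second one as the
  adjoint of the difference matrix, so the one-dimensional bound adds up.
\<close>

lemma TV_matrix_adjoint_bound:
  fixes w :: "real^('n::{finite,linorder} \<times> 'm::{finite,linorder} + 'm \<times> 'n)"
  assumes card: "CARD('n) = CARD('m) + 1"
  shows "2 * sin (pi / (2 * real CARD('n))) * norm w \<le> norm (transpose TV_matrix *v w)"
proof -
  let ?c = "(2 * sin (pi / (2 * real CARD('n))))\<^sup>2"
  let ?D = "diff_matrix :: real^'n::{finite,linorder}^'m::{finite,linorder}"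
  have l: "(transpose TV_matrix *v w) $ Inl (a, j) = (\<Sum>i\<in>UNIV. ?D $ i $ j * w $ Inl (a, i))" for a j
    by (simp add: matrix_vector_mult_def transpose_def TV_matrix_def block_matrix_def kronecker_def
        sum_UNIV_Plus sum_UNIV_Times mat_def if_distrib[of "\<lambda>z. z * _"] cong: if_cong)
      (subst sum.swap, simp)
  have r: "(transpose TV_matrix *v w) $ Inr (j, b) = (\<Sum>i\<in>UNIV. ?D $ i $ j * w $ Inr (i, b))" for b j
    by (simp add: matrix_vector_mult_def transpose_def TV_matrix_def block_matrix_def kronecker_def
        sum_UNIV_Plus sum_UNIV_Times mat_def if_distrib[of "\<lambda>z. _ * z * _"]
        if_distrib[of "\<lambda>z. z * _"] cong: if_cong)
  have w: "(norm w)\<^sup>2 = (\<Sum>a\<in>UNIV. \<Sum>i\<in>UNIV. (w $ Inl (a, i))\<^sup>2)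
      + (\<Sum>b\<in>UNIV. \<Sum>i\<in>UNIV. (w $ Inr (i, b))\<^sup>2)"
    unfolding power2_norm_vec sum_UNIV_Plus sum_UNIV_Times
    by (simp add: sum.swap[of "\<lambda>i b. (w $ Inr (i, b))\<^sup>2"])
  have Tw: "(norm (transpose TV_matrix *v w))\<^sup>2
      = (\<Sum>a\<in>UNIV. \<Sum>j\<in>UNIV. (\<Sum>i\<in>UNIV. ?D $ i $ j * w $ Inl (a, i))\<^sup>2)
      + (\<Sum>b\<in>UNIV. \<Sum>j\<in>UNIV. (\<Sum>i\<in>UNIV. ?D $ i $ j * w $ Inr (i, b))\<^sup>2)"
    unfolding power2_norm_vec sum_UNIV_Plus sum_UNIV_Times l r
    by (simp add: sum.swap[of "\<lambda>j b. (\<Sum>i\<in>UNIV. ?D $ i $ j * w $ Inr (i, b))\<^sup>2"])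
  have "?c * (norm w)\<^sup>2 \<le> (norm (transpose TV_matrix *v w))\<^sup>2"
    unfolding w Tw distrib_left sum_distrib_left[of _ _ UNIV]
    using diff_matrix_adjoint_bound[OF refl card]
    by (intro add_mono sum_mono) (simp_all add: sum_distrib_left)
  then have "(2 * sin (pi / (2 * real CARD('n))) * norm w)\<^sup>2 \<le> (norm (transpose TV_matrix *v w))\<^sup>2"
    by (simp only: power_mult_distrib)
  then show ?thesis by (rule power2_le_imp_le) simp
qed

text \<open>
  The coupling block of \<open>K_matrix\<close> is \<open>\<beta>\<close> times that of \<open>K0_matrix\<close>, and the other blocks agree.
\<close>

lemma norm_K0_le_norm_K:
  assumes "\<beta> \<ge> 1"
  shows "(norm (K0_matrix Kt *v x))\<^sup>2 \<le> (norm (K_matrix \<beta> Kt *v x))\<^sup>2"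
  unfolding power2_norm_vec
proof (rule sum_mono)
  fix i :: "'a + 'a"
  have "1 \<le> \<beta>\<^sup>2" using assms by simp
  show "((K0_matrix Kt *v x) $ i)\<^sup>2 \<le> ((K_matrix \<beta> Kt *v x) $ i)\<^sup>2"
  proof (cases i)
    case (Inl a)
    then show ?thesis
      by (simp add: matrix_vector_mult_def K_matrix_def K0_matrix_def block_matrix_def sum_UNIV_Plus)
  next
    case (Inr b)
    have "(K_matrix \<beta> Kt *v x) $ i = \<beta> * (K0_matrix Kt *v x) $ i"
      unfolding Inr by (simp add: matrix_vector_mult_def K_matrix_def K0_matrix_def
          block_matrix_def sum_UNIV_Plus sum_distrib_left algebra_simps sum_negf)
    then show ?thesis
      using mult_right_mono[OF \<open>1 \<le> \<beta>\<^sup>2\<close>, of "((K0_matrix Kt *v x) $ i)\<^sup>2"]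
      by (simp add: power_mult_distrib)
  qed
qed

section \<open>Descent of the inertial ADMM\<close>

lemma power2_norm_add: "(norm (x + y))\<^sup>2 = (norm x)\<^sup>2 + 2 * (x \<bullet> y) + (norm (y::'a::real_inner))\<^sup>2"
  by (simp add: power2_norm_eq_inner inner_add_left inner_add_right inner_commute)

text \<open>
  In \<open>u\<close> the augmented Lagrangian is a quadratic polynomial, so this expansion is exact. It gives
  the optimality condition of the \<open>u\<close> update, its quadratic growth, and the gradient that enters
  the subgradient below.
\<close>

lemma aug_lagrangian_add_primal:
  "aug_lagrangian K f T \<phi> \<sigma> \<delta> (u + a) v p = aug_lagrangian K f T \<phi> \<sigma> \<delta> u v p
    + (transpose K *v (K *v u - f) - transpose T *v p + \<delta> *\<^sub>R (transpose T *v (T *v u - v))) \<bullet> a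
    + (1 / 2 * (norm (K *v a))\<^sup>2 + \<delta> / 2 * (norm (T *v a))\<^sup>2)"
proof -
  have K: "K *v (u + a) - f = (K *v u - f) + K *v a"
    and T: "T *v (u + a) - v = (T *v u - v) + T *v a"
    by (simp_all add: matrix_vector_right_distrib)
  show ?thesis
    unfolding aug_lagrangian_def K T power2_norm_add inner_add_left inner_diff_left
      inner_add_right[of p] inner_scaleR_left inner_transpose_mult_left
    by (simp add: field_simps)
qed

lemma aug_lagrangian_argmin_stationary:
  assumes "is_arg_min (\<lambda>u. aug_lagrangian K f T \<phi> \<sigma> \<delta> u v p) (\<lambda>_. True) u"
  shows "transpose K *v (K *v u - f) - transpose T *v p + \<delta> *\<^sub>R (transpose T *v (T *v u - v)) = 0"
    (is "?g = 0")
proof -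
  define g where "g = ?g"
  have "0 \<le> t * (g \<bullet> g) + t\<^sup>2 * (1 / 2 * (norm (K *v g))\<^sup>2 + \<delta> / 2 * (norm (T *v g))\<^sup>2)" for t
  proof -
    have "aug_lagrangian K f T \<phi> \<sigma> \<delta> u v p \<le> aug_lagrangian K f T \<phi> \<sigma> \<delta> (u + t *\<^sub>R g) v p"
      using assms by (auto simp: is_arg_min_linorder)
    then show ?thesis
      unfolding aug_lagrangian_add_primal[of _ _ _ _ _ _ u "t *\<^sub>R g"] g_def[symmetric]
      by (simp add: matrix_vector_mult_scaleR power_mult_distrib algebra_simps)
  qed
  then have "g \<bullet> g = 0" by (rule quadratic_nonneg_imp_linear_coeff_zero)
  then show ?thesis by (simp add: g_def)
qed

lemma aug_lagrangian_add_multiplier: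
  "aug_lagrangian K f T \<phi> \<sigma> \<delta> u v (p + q) = aug_lagrangian K f T \<phi> \<sigma> \<delta> u v p - q \<bullet> (T *v u - v)"
  by (simp add: aug_lagrangian_def inner_add_left)

lemma norm_transpose_mult_le:
  fixes K :: "real^'n^'m"
  shows "norm (transpose K *v y) \<le> onorm ((*v) K) * norm y"
proof (cases "transpose K *v y = 0")
  case True
  then show ?thesis by (simp add: onorm_pos_le matrix_vector_mul_bounded_linear)
next
  case False
  have "(norm (transpose K *v y))\<^sup>2 = y \<bullet> (K *v (transpose K *v y))"
    unfolding power2_norm_eq_inner inner_transpose_mult_left ..
  also have "\<dots> \<le> norm y * norm (K *v (transpose K *v y))"
    by (rule norm_cauchy_schwarz)
  also have "\<dots> \<le> norm y * (onorm ((*v) K) * norm (transpose K *v y))"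
    by (intro mult_left_mono onorm matrix_vector_mul_bounded_linear) simp
  finally have "norm (transpose K *v y) * norm (transpose K *v y)
      \<le> (onorm ((*v) K) * norm y) * norm (transpose K *v y)"
    by (simp only: power2_eq_square mult_ac)
  with False show ?thesis by (simp only: mult_le_cancel_right) simp
qed

text \<open>
  The gain \<open>e\<close> exceeds the losses \<open>b + c\<close> caused by the two preceding increments, so the quantity
  \<open>E\<close> that adds to \<open>L\<close> the losses still to come decreases by a fixed multiple of \<open>D\<close>. A bound for
  \<open>L\<close> that holds infinitely often is enough: it bounds a monotone sequence everywhere.
\<close>

lemma descent_with_memory_tendsto_zero:
  fixes L D :: "nat \<Rightarrow> real"
  assumes step: "\<And>k. L (Suc k) \<le> L k - e * D (Suc (Suc k)) + b * D (Suc k) + c * D k"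
    and D: "\<And>k. 0 \<le> D k" and b: "0 \<le> b" and c: "0 \<le> c" and e: "b + c < e"
    and bdd: "\<exists>\<^sub>F k in sequentially. B \<le> L k"
  shows "D \<longlonglongrightarrow> 0"
proof -
  define E where "E k = L k + (b + c) * D (Suc k) + c * D k" for k
  have dec: "(e - (b + c)) * D (Suc (Suc k)) \<le> E k - E (Suc k)" for k
    using step[of k] by (simp add: E_def algebra_simps)
  have "0 \<le> (e - (b + c)) * D (Suc (Suc k))" for k using D e by simp
  with dec have "E (Suc k) \<le> E k" for k by (metis diff_ge_0_iff_ge order_trans)
  then have E: "decseq E" by (rule decseq_SucI)
  have "B \<le> E k" for k
  proof -
    obtain m where m: "m \<ge> k" "B \<le> L m"
      using bdd unfolding frequently_sequentially by blast
    have "B \<le> E m"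
      using m(2) D[of m] D[of "Suc m"] b c unfolding E_def
      by (meson add_increasing2 add_nonneg_nonneg mult_nonneg_nonneg)
    also have "E m \<le> E k" using E m(1) by (simp add: decseqD)
    finally show ?thesis .
  qed
  then have "\<forall>k. B \<le> E k" ..
  then obtain l where "E \<longlonglongrightarrow> l" by (rule decseq_convergent[OF E])
  then have up: "(\<lambda>k. (E k - E (Suc k)) / (e - (b + c))) \<longlonglongrightarrow> (l - l) / (e - (b + c))"
    using e by (intro tendsto_intros LIMSEQ_Suc) auto
  have "(\<lambda>k. D (Suc (Suc k))) \<longlonglongrightarrow> 0"
  proof (rule tendsto_sandwich[where f = "\<lambda>_. 0"])
    show "\<forall>\<^sub>F k in sequentially. D (Suc (Suc k)) \<le> (E k - E (Suc k)) / (e - (b + c))"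
      using dec e by (simp add: field_simps)
    show "(\<lambda>k. (E k - E (Suc k)) / (e - (b + c))) \<longlonglongrightarrow> 0" using up by simp
  qed (use D in auto)
  then show ?thesis by (intro LIMSEQ_imp_Suc[of D] LIMSEQ_imp_Suc[of "\<lambda>k. D (Suc k)"])
qed

text \<open>
  Indices are shifted by one against the update rule, so that no predecessor of an index occurs:
  \<open>ph k\<close> is the multiplier extrapolated from \<open>p (k + 1)\<close> and \<open>p k\<close>, and it is used to compute the
  iterates with index \<open>k + 2\<close>.
\<close>

locale inertial_ADMM =
  fixes K :: "real^'c^'r" and f :: "real^'r" and T :: "real^'c^'d" and \<phi> :: "real \<Rightarrow> real"
    and \<sigma> \<alpha> \<delta> :: real and u :: "nat \<Rightarrow> real^'c" and v p :: "nat \<Rightarrow> real^'d"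
  assumes sequence: "IADMM_sequence K f T \<phi> \<sigma> \<alpha> \<delta> u v p"
    and delta_pos: "0 < \<delta>"
begin

abbreviation "L \<equiv> aug_lagrangian K f T \<phi> \<sigma> \<delta>"

definition q where "q k = p (Suc k) - p k"

definition ph where "ph k = p (Suc k) + \<alpha> *\<^sub>R q k"

lemma
  shows v_argmin: "is_arg_min (\<lambda>v'. L (u (Suc k)) v' (ph k)) (\<lambda>_. True) (v (Suc (Suc k)))"
    and u_argmin: "is_arg_min (\<lambda>u'. L u' (v (Suc (Suc k))) (ph k)) (\<lambda>_. True) (u (Suc (Suc k)))"
    and p_update: "p (Suc (Suc k)) = ph k - \<delta> *\<^sub>R (T *v u (Suc (Suc k)) - v (Suc (Suc k)))"
proof -
  have "\<forall>k\<ge>1. let ph = p k + \<alpha> *\<^sub>R (p k - p (k - 1)) in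
        is_arg_min (\<lambda>v'. L (u k) v' ph) (\<lambda>_. True) (v (k + 1)) \<and>
        is_arg_min (\<lambda>u'. L u' (v (k + 1)) ph) (\<lambda>_. True) (u (k + 1)) \<and>
        p (k + 1) = ph - \<delta> *\<^sub>R (T *v u (k + 1) - v (k + 1))"
    using sequence unfolding IADMM_sequence_def by blast
  from this[THEN spec, of "Suc k"]
  show "is_arg_min (\<lambda>v'. L (u (Suc k)) v' (ph k)) (\<lambda>_. True) (v (Suc (Suc k)))"
    "is_arg_min (\<lambda>u'. L u' (v (Suc (Suc k))) (ph k)) (\<lambda>_. True) (u (Suc (Suc k)))"
    "p (Suc (Suc k)) = ph k - \<delta> *\<^sub>R (T *v u (Suc (Suc k)) - v (Suc (Suc k)))"
    by (simp_all add: Let_def ph_def q_def)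
qed

lemma residual: "T *v u (Suc (Suc k)) - v (Suc (Suc k)) = (1 / \<delta>) *\<^sub>R (\<alpha> *\<^sub>R q k - q (Suc k))"
proof -
  have "\<delta> *\<^sub>R (T *v u (Suc (Suc k)) - v (Suc (Suc k))) = \<alpha> *\<^sub>R q k - q (Suc k)"
    using p_update[of k] by (simp add: ph_def q_def algebra_simps)
  then have "(1 / \<delta>) *\<^sub>R (\<delta> *\<^sub>R (T *v u (Suc (Suc k)) - v (Suc (Suc k)))) = (1 / \<delta>) *\<^sub>R (\<alpha> *\<^sub>R q k - q (Suc k))"
    by (rule arg_cong)
  then show ?thesis using delta_pos by simp
qed

text \<open>
  The multiplier update is chosen such that the stationarity of the \<open>u\<close> update becomes this identity
  between iterates of the same index. It holds from index \<open>2\<close> on; the starting multiplier is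
  arbitrary.
\<close>

lemma multiplier_identity:
  "transpose T *v p (Suc (Suc k)) = transpose K *v (K *v u (Suc (Suc k)) - f)"
  using aug_lagrangian_argmin_stationary[OF u_argmin[of k]]
  by (simp add: p_update[of k] matrix_vector_mult_diff_distrib matrix_vector_mult_scaleR algebra_simps
      del: transpose_matrix_vector)

text \<open>
  The \<open>v\<close> update does not increase the Lagrangian, the \<open>u\<close> update decreases it by the quadratic
  growth around the minimiser, and the two changes of multiplier, the extrapolation to \<open>ph\<close> and
  the step from \<open>ph\<close> to the new multiplier, cost products of multiplier increments with
  constraint residuals. The residuals are themselves combinations of multiplier increments, with
  a factor \<open>1 / \<delta>\<close>.
\<close>

lemma descent:
  assumes conv: "\<And>x. \<nu> * (norm x)\<^sup>2 \<le> (norm (K *v x))\<^sup>2 + \<delta> * (norm (T *v x))\<^sup>2"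
  shows "L (u (k + 3)) (v (k + 3)) (p (k + 3)) \<le> L (u (k + 2)) (v (k + 2)) (p (k + 2))
     - \<nu> / 2 * (norm (u (k + 3) - u (k + 2)))\<^sup>2
     + (2 * (norm (q (k + 2)))\<^sup>2 + (1 / 2 + 3 * \<alpha>\<^sup>2) * (norm (q (k + 1)))\<^sup>2 + \<alpha>\<^sup>2 / 2 * (norm (q k))\<^sup>2) / \<delta>"
proof -
  define a b c where "a = q (k + 2)" and "b = q (k + 1)" and "c = q k"
  have ph: "ph (k + 1) = p (k + 2) + \<alpha> *\<^sub>R b" "p (k + 3) = p (k + 2) + a"
    by (simp_all add: ph_def a_def b_def q_def numeral_2_eq_2 numeral_3_eq_3)
  have res: "T *v u (k + 3) - v (k + 3) = (1 / \<delta>) *\<^sub>R (\<alpha> *\<^sub>R b - a)"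
    "T *v u (k + 2) - v (k + 2) = (1 / \<delta>) *\<^sub>R (\<alpha> *\<^sub>R c - b)"
    using residual[of "k + 1"] residual[of k]
    by (simp_all add: a_def b_def c_def numeral_2_eq_2 numeral_3_eq_3)
  have "L (u (k + 2)) (v (k + 3)) (ph (k + 1)) \<le> L (u (k + 2)) (v (k + 2)) (ph (k + 1))"
    using v_argmin[of "k + 1"] by (simp add: is_arg_min_linorder numeral_2_eq_2 numeral_3_eq_3)
  moreover have "L (u (k + 2)) (v (k + 3)) (ph (k + 1)) \<ge> L (u (k + 3)) (v (k + 3)) (ph (k + 1))
      + \<nu> / 2 * (norm (u (k + 3) - u (k + 2)))\<^sup>2"
  proof -
    have st: "transpose K *v (K *v u (k + 3) - f) - transpose T *v ph (k + 1)
        + \<delta> *\<^sub>R (transpose T *v (T *v u (k + 3) - v (k + 3))) = 0"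
      using aug_lagrangian_argmin_stationary[OF u_argmin[of "k + 1"]]
      by (simp add: numeral_2_eq_2 numeral_3_eq_3)
    have "L (u (k + 3) + (u (k + 2) - u (k + 3))) (v (k + 3)) (ph (k + 1))
      \<ge> L (u (k + 3)) (v (k + 3)) (ph (k + 1)) + \<nu> / 2 * (norm (u (k + 2) - u (k + 3)))\<^sup>2"
      unfolding aug_lagrangian_add_primal st using conv[of "u (k + 2) - u (k + 3)"] by simp
    then show ?thesis by (simp add: norm_minus_commute)
  qed
  moreover have "L (u (k + 2)) (v (k + 2)) (ph (k + 1)) = L (u (k + 2)) (v (k + 2)) (p (k + 2))
      + (\<alpha> * (b \<bullet> b) - \<alpha>\<^sup>2 * (b \<bullet> c)) / \<delta>"
    unfolding ph aug_lagrangian_add_multiplier res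
    by (simp add: inner_diff_right power2_eq_square algebra_simps diff_divide_distrib)
  moreover have "L (u (k + 3)) (v (k + 3)) (p (k + 3)) = L (u (k + 3)) (v (k + 3)) (ph (k + 1))
      + (norm (a - \<alpha> *\<^sub>R b))\<^sup>2 / \<delta>"
    unfolding ph aug_lagrangian_add_multiplier res
    by (simp add: inner_diff_right inner_diff_left power2_norm_eq_inner inner_commute algebra_simps
        diff_divide_distrib add_divide_distrib)
  moreover have "(norm (a - \<alpha> *\<^sub>R b))\<^sup>2 / \<delta> + (\<alpha> * (b \<bullet> b) - \<alpha>\<^sup>2 * (b \<bullet> c)) / \<delta>
     \<le> (2 * (norm a)\<^sup>2 + (1 / 2 + 3 * \<alpha>\<^sup>2) * (norm b)\<^sup>2 + \<alpha>\<^sup>2 / 2 * (norm c)\<^sup>2) / \<delta>"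
  proof -
    \<comment> \<open>The three squares by which the mixed products are absorbed; their weights make the coefficients add up to \<open>(5 + 7 \<alpha>\<^sup>2) / 2\<close>.\<close>
    have "0 \<le> (norm (a + \<alpha> *\<^sub>R b))\<^sup>2" "0 \<le> \<alpha>\<^sup>2 * (norm (b + c))\<^sup>2" "0 \<le> (1 - \<alpha>)\<^sup>2 * (norm b)\<^sup>2"
      by simp_all
    then have "(norm (a - \<alpha> *\<^sub>R b))\<^sup>2 + (\<alpha> * (b \<bullet> b) - \<alpha>\<^sup>2 * (b \<bullet> c))
     \<le> 2 * (norm a)\<^sup>2 + (1 / 2 + 3 * \<alpha>\<^sup>2) * (norm b)\<^sup>2 + \<alpha>\<^sup>2 / 2 * (norm c)\<^sup>2"
      unfolding power2_norm_eq_inner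
      by (simp add: inner_add_left inner_add_right inner_diff_left inner_diff_right inner_commute
        algebra_simps power2_eq_square)
    then show ?thesis
      unfolding add_divide_distrib[symmetric] using delta_pos by (intro divide_right_mono) auto
  qed
  ultimately show ?thesis unfolding a_def b_def c_def by linarith
qed

end

section \<open>Cluster points\<close>

lemma lower_semicontinuous_eventually_ge:
  fixes X :: "'b \<Rightarrow> real"
  assumes lsc: "lower_semicontinuous \<phi>" and X: "(X \<longlongrightarrow> x) F"
  shows "\<forall>\<^sub>F k in F. \<phi> x - 1 \<le> \<phi> (X k)"
proof -
  have "ereal (\<phi> x - 1) < ereal (\<phi> x)" by simp
  also have "\<dots> \<le> Liminf (at x) (\<lambda>y. ereal (\<phi> y))"
    using lsc by (simp add: lower_semicontinuous_def)
  finally have "ereal (\<phi> x - 1) < Liminf (at x) (\<lambda>y. ereal (\<phi> y))" .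
  then have "\<forall>\<^sub>F y in at x. \<phi> x - 1 < \<phi> y"
    by (auto dest: less_LiminfD)
  then have "\<forall>\<^sub>F y in nhds x. \<phi> x - 1 \<le> \<phi> y"
    unfolding eventually_at_filter by (rule eventually_mono) force
  then show ?thesis
    using X by (auto simp: filterlim_iff)
qed

text \<open>
  Semicontinuity bounds the regularisation term, the two squares are nonnegative, and the pairing
  with the multiplier converges.
\<close>

lemma aug_lagrangian_eventually_bounded_below:
  assumes lsc: "lower_semicontinuous \<phi>" and pos: "0 \<le> \<sigma>" "0 \<le> \<delta>"
    and u: "(U \<longlongrightarrow> u) F" and v: "(V \<longlongrightarrow> v) F" and p: "(P \<longlongrightarrow> p) F"
  shows "\<exists>B. \<forall>\<^sub>F k in F. B \<le> aug_lagrangian K f T \<phi> \<sigma> \<delta> (U k) (V k) (P k)"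
proof -
  define l where "l = p \<bullet> (T *v u - v)"
  have "((\<lambda>k. P k \<bullet> (T *v U k - V k)) \<longlongrightarrow> l) F"
    unfolding l_def
    by (intro tendsto_intros u v p bounded_linear.tendsto[OF matrix_vector_mul_bounded_linear])
  then have 1: "\<forall>\<^sub>F k in F. P k \<bullet> (T *v U k - V k) < l + 1"
    by (rule order_tendstoD) simp
  have 2: "\<forall>\<^sub>F k in F. \<forall>i. \<phi> (v $ i) - 1 \<le> \<phi> (V k $ i)"
    by (intro eventually_all_finite lower_semicontinuous_eventually_ge[OF lsc] tendsto_vec_nth v)
  show ?thesis
  proof (rule exI, rule eventually_mono[OF eventually_conj[OF 1 2]], elim conjE)
    fix k
    assume 1: "P k \<bullet> (T *v U k - V k) < l + 1" and 2: "\<forall>i. \<phi> (v $ i) - 1 \<le> \<phi> (V k $ i)"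
    have "(\<Sum>i\<in>UNIV. \<phi> (v $ i) - 1) \<le> reg \<phi> (V k)"
      unfolding reg_def using 2 by (intro sum_mono) blast
    then have "\<sigma> * (\<Sum>i\<in>UNIV. \<phi> (v $ i) - 1) \<le> \<sigma> * reg \<phi> (V k)"
      using pos by (intro mult_left_mono)
    moreover have "0 \<le> \<delta> / 2 * (norm (T *v U k - V k))\<^sup>2"
      "0 \<le> 1 / 2 * (norm (K *v U k - f))\<^sup>2" using pos by auto
    ultimately show "\<sigma> * (\<Sum>i\<in>UNIV. \<phi> (v $ i) - 1) - (l + 1)
        \<le> aug_lagrangian K f T \<phi> \<sigma> \<delta> (U k) (V k) (P k)"
      using 1 unfolding aug_lagrangian_def by linarith
  qed
qed

text \<open>
  A quadratic lower bound makes the quotient at least \<open>- C * norm (y - x)\<close>, which tends to zero.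
\<close>

lemma Liminf_quotient_nonneg:
  fixes x :: "'a::real_inner"
  assumes "\<And>y. - (C * (norm (y - x))\<^sup>2) \<le> g y"
  shows "0 \<le> Liminf (at x) (\<lambda>y. ereal (g y / norm (y - x)))"
proof (rule order_trans)
  have "((\<lambda>y. - (C * norm (y - x))) \<longlongrightarrow> - (C * norm (x - x))) (at x)"
    by (intro tendsto_intros)
  then have *: "((\<lambda>y. ereal (- (C * norm (y - x)))) \<longlongrightarrow> 0) (at x)"
    by (simp add: zero_ereal_def)
  show "0 \<le> Liminf (at x) (\<lambda>y. ereal (- (C * norm (y - x))))"
  proof (cases "at x = bot")
    case False
    then show ?thesis using lim_imp_Liminf[OF False *] by simp
  qed (simp add: Liminf_bot)
  have "\<forall>\<^sub>F y in at x. - (C * norm (y - x)) \<le> g y / norm (y - x)"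
    unfolding eventually_at_filter
  proof (intro always_eventually allI impI)
    fix y assume "y \<noteq> x"
    then have n: "0 < norm (y - x)" by simp
    show "- (C * norm (y - x)) \<le> g y / norm (y - x)"
      using assms[of y] n by (simp add: le_divide_eq power2_eq_square mult.assoc)
  qed
  then show "Liminf (at x) (\<lambda>y. ereal (- (C * norm (y - x)))) \<le> Liminf (at x) (\<lambda>y. ereal (g y / norm (y - x)))"
    by (intro Liminf_mono) simp
qed

text \<open>
  The nonsmooth part involves \<open>v\<close> alone, and \<open>v\<close> minimises with \<open>u\<close> and \<open>p\<close> fixed. Moving \<open>v\<close>
  first therefore does not decrease the value, and the rest of the move is a quadratic polynomial
  in the increments, whose linear part is the given vector and whose quadratic part is at least a
  negative multiple of the squared distance. The \<open>v\<close> component of the subgradient is exactly zero.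
\<close>

lemma aug_lagrangian_regular_subgradient:
  fixes K :: "real^'c^'r" and T :: "real^'c^'d"
  assumes argmin: "is_arg_min (\<lambda>v'. aug_lagrangian K f T \<phi> \<sigma> \<delta> u v' p) (\<lambda>_. True) v"
    and \<delta>: "0 \<le> \<delta>"
  defines "g \<equiv> transpose K *v (K *v u - f) - transpose T *v p + \<delta> *\<^sub>R (transpose T *v (T *v u - v))"
    and "J \<equiv> \<lambda>(x, y, z). aug_lagrangian K f T \<phi> \<sigma> \<delta> x y z"
  shows "0 \<le> Liminf (at (u, v, p)) (\<lambda>y. ereal
    ((J y - J (u, v, p) - (g, 0, - (T *v u - v)) \<bullet> (y - (u, v, p))) / norm (y - (u, v, p))))"
proof (rule Liminf_quotient_nonneg)
  define t where "t = onorm ((*v) T)"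
  have t: "0 \<le> t" "norm (T *v a) \<le> t * norm a" for a
    unfolding t_def by (auto intro!: onorm_pos_le onorm matrix_vector_mul_bounded_linear)
  fix y :: "(real^'c) \<times> (real^'d) \<times> (real^'d)"
  define n where "n = norm (y - (u, v, p))"
  obtain a b c where y: "y = (u + a, v + b, p + c)"
    by (metis (no_types) add_diff_cancel_left' diff_add_cancel add.commute prod.collapse)
  have abc: "norm a \<le> n" "norm b \<le> n" "norm c \<le> n"
  proof -
    have n: "n = norm (a, b, c)" by (simp add: n_def y)
    show "norm a \<le> n" by (simp add: n norm_fst_le)
    have "norm (b, c) \<le> n" by (simp add: n norm_snd_le)
    then show "norm b \<le> n" "norm c \<le> n"
      by (auto intro: order_trans norm_fst_le norm_snd_le)
  qed
  have Ta: "norm (T *v a) \<le> t * n"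
    using t(2)[of a] mult_left_mono[OF abc(1) t(1)] by linarith
  have n0: "0 \<le> n" by (simp add: n_def)
  have "aug_lagrangian K f T \<phi> \<sigma> \<delta> u v p \<le> aug_lagrangian K f T \<phi> \<sigma> \<delta> u (v + b) p"
    using argmin by (simp add: is_arg_min_linorder)
  moreover have "aug_lagrangian K f T \<phi> \<sigma> \<delta> (u + a) (v + b) (p + c)
      = aug_lagrangian K f T \<phi> \<sigma> \<delta> u (v + b) p + (g \<bullet> a - c \<bullet> (T *v u - v))
        - c \<bullet> (T *v a) + c \<bullet> b - \<delta> * (b \<bullet> (T *v a))
        + (1 / 2 * (norm (K *v a))\<^sup>2 + \<delta> / 2 * (norm (T *v a))\<^sup>2)"
    unfolding aug_lagrangian_add_primal aug_lagrangian_add_multiplier g_def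
    unfolding inner_add_left inner_diff_left inner_scaleR_left inner_transpose_mult_left
    by (simp add: inner_diff_right inner_add_left inner_add_right inner_diff_left algebra_simps)
  moreover have "c \<bullet> (T *v a) \<le> t * n\<^sup>2"
  proof -
    have "c \<bullet> (T *v a) \<le> n * (t * n)"
      using norm_cauchy_schwarz[of c "T *v a"] mult_mono[OF abc(3) Ta] n0 by simp
    then show ?thesis by (simp add: power2_eq_square mult_ac)
  qed
  moreover have "- (n\<^sup>2) \<le> c \<bullet> b"
  proof -
    have "\<bar>c \<bullet> b\<bar> \<le> n * n"
      using Cauchy_Schwarz_ineq2[of c b] mult_mono[OF abc(3) abc(2)] n0 by simp
    then show ?thesis by (simp add: power2_eq_square)
  qed
  moreover have "\<delta> * (b \<bullet> (T *v a)) \<le> \<delta> * (t * n\<^sup>2)"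
  proof -
    have "b \<bullet> (T *v a) \<le> n * (t * n)"
      using norm_cauchy_schwarz[of b "T *v a"] mult_mono[OF abc(2) Ta] n0 by simp
    then show ?thesis using \<delta> by (intro mult_left_mono) (simp_all add: power2_eq_square mult_ac)
  qed
  moreover have "0 \<le> 1 / 2 * (norm (K *v a))\<^sup>2 + \<delta> / 2 * (norm (T *v a))\<^sup>2"
    using \<delta> by simp
  moreover have "(t + 1 + \<delta> * t) * n\<^sup>2 = t * n\<^sup>2 + n\<^sup>2 + \<delta> * (t * n\<^sup>2)"
    by (simp add: algebra_simps)
  moreover have "J y - J (u, v, p) - (g, 0, - (T *v u - v)) \<bullet> (y - (u, v, p))
     = aug_lagrangian K f T \<phi> \<sigma> \<delta> (u + a) (v + b) (p + c) - aug_lagrangian K f T \<phi> \<sigma> \<delta> u v p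
       - (g \<bullet> a - c \<bullet> (T *v u - v))"
    unfolding y J_def by (simp add: inner_commute inner_diff_right)
  ultimately show "- ((t + 1 + \<delta> * t) * (norm (y - (u, v, p)))\<^sup>2)
     \<le> J y - J (u, v, p) - (g, 0, - (T *v u - v)) \<bullet> (y - (u, v, p))"
    unfolding n_def[symmetric] by linarith
qed

text \<open>
  Vanishing increments let a subsequential limit pass to neighbouring indices, although the whole
  sequence need not converge.
\<close>

lemma tendsto_subseq_shift:
  fixes X :: "nat \<Rightarrow> 'a::real_normed_vector"
  assumes X: "(\<lambda>k. X (r k)) \<longlonglongrightarrow> x" and r: "strict_mono r"
    and diff: "(\<lambda>k. X (Suc k) - X k) \<longlonglongrightarrow> 0"
  shows "(\<lambda>k. X (r k + m)) \<longlonglongrightarrow> x"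
proof (induction m)
  case 0
  then show ?case using X by simp
next
  case (Suc m)
  have "filterlim (\<lambda>k. r k + m) sequentially sequentially"
    using filterlim_subseq[OF r] by (rule filterlim_at_top_mono) simp
  from tendsto_add[OF filterlim_compose[OF diff this] Suc] show ?case by simp
qed

context inertial_ADMM
begin

text \<open>
  By the multiplier identity the adjoint of \<open>T\<close> maps a multiplier increment to the adjoint of \<open>K\<close>
  applied to \<open>K\<close> of the increment of \<open>u\<close>; as the adjoint of \<open>T\<close> is bounded below by \<open>\<tau>\<close>, the
  increments of \<open>u\<close> control those of the multipliers.
\<close>

lemma multiplier_increment_bound:
  assumes adj: "\<And>w. \<tau> * norm w \<le> norm (transpose T *v w)" and \<tau>: "0 < \<tau>"
  shows "(norm (q (k + 2)))\<^sup>2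
    \<le> onorm ((*v) K) ^ 4 / \<tau>\<^sup>2 * (norm (u (k + 3) - u (k + 2)))\<^sup>2"
proof -
  define d where "d = u (k + 3) - u (k + 2)"
  define N where "N = onorm ((*v) K)"
  have N: "0 \<le> N" "norm (K *v d) \<le> N * norm d"
    unfolding N_def by (auto intro!: onorm_pos_le onorm matrix_vector_mul_bounded_linear)
  have "transpose T *v q (k + 2) = transpose K *v (K *v d)"
    using multiplier_identity[of k] multiplier_identity[of "k + 1"]
    by (simp add: q_def d_def numeral_2_eq_2 numeral_3_eq_3 matrix_vector_mult_diff_distrib
        del: transpose_matrix_vector)
  then have "\<tau> * norm (q (k + 2)) \<le> N * norm (K *v d)"
    using adj[of "q (k + 2)"] norm_transpose_mult_le[of K "K *v d"] by (simp add: N_def)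
  also have "\<dots> \<le> N * (N * norm d)" using N by (intro mult_left_mono)
  finally have "(\<tau> * norm (q (k + 2)))\<^sup>2 \<le> (N * (N * norm d))\<^sup>2"
    using \<tau> by (intro power_mono) auto
  then have "\<tau>\<^sup>2 * (norm (q (k + 2)))\<^sup>2 \<le> N ^ 4 * (norm d)\<^sup>2"
    by (simp add: power_mult_distrib power2_eq_square power4_eq_xxxx mult_ac)
  then show ?thesis using \<tau> by (simp add: d_def N_def field_simps)
qed

text \<open>
  In the descent estimate every multiplier increment is replaced by an increment of \<open>u\<close>, at the
  price of the factor \<open>M\<close>. The losses then add up to \<open>(5 + 7 \<alpha>\<^sup>2) M / (2 \<delta>)\<close>, and the lower bound
  on \<open>\<delta>\<close> makes the gain \<open>\<nu> / 2\<close> exceed them.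
\<close>

lemma increments_tendsto_zero:
  assumes conv: "\<And>x. \<nu> * (norm x)\<^sup>2 \<le> (norm (K *v x))\<^sup>2 + \<delta> * (norm (T *v x))\<^sup>2"
    and adj: "\<And>w. \<tau> * norm w \<le> norm (transpose T *v w)" and \<tau>: "0 < \<tau>"
    and large: "(5 + 7 * \<alpha>\<^sup>2) * (onorm ((*v) K) ^ 4 / \<tau>\<^sup>2) < \<nu> * \<delta>"
    and bdd: "\<exists>\<^sub>F k in sequentially. B \<le> L (u k) (v k) (p k)"
  shows "(\<lambda>k. u (Suc k) - u k) \<longlonglongrightarrow> 0" and "q \<longlonglongrightarrow> 0"
proof -
  define M where "M = onorm ((*v) K) ^ 4 / \<tau>\<^sup>2"
  define D where "D k = (norm (u (k + 3) - u (k + 2)))\<^sup>2" for k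
  have M0: "0 \<le> M" by (simp add: M_def)
  have qD: "(norm (q (k + 2)))\<^sup>2 \<le> M * D k" for k
    using multiplier_increment_bound[OF adj \<tau>] by (simp add: M_def D_def)
  have D0: "D \<longlonglongrightarrow> 0"
  \<comment> \<open>The multiplier bound is available from index \<open>2\<close> on and the estimate looks back two steps, so the values of \<open>L\<close> start at index \<open>4\<close>.\<close>
  proof (rule descent_with_memory_tendsto_zero)
    fix k
    have "L (u (k + 5)) (v (k + 5)) (p (k + 5)) \<le> L (u (k + 4)) (v (k + 4)) (p (k + 4)) - \<nu> / 2 * D (k + 2)
     + (2 * (norm (q (k + 4)))\<^sup>2 + (1 / 2 + 3 * \<alpha>\<^sup>2) * (norm (q (k + 3)))\<^sup>2 + \<alpha>\<^sup>2 / 2 * (norm (q (k + 2)))\<^sup>2) / \<delta>"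
      using descent[OF conv, of "k + 2"] by (simp add: D_def eval_nat_numeral)
    also have "(2 * (norm (q (k + 4)))\<^sup>2 + (1 / 2 + 3 * \<alpha>\<^sup>2) * (norm (q (k + 3)))\<^sup>2 + \<alpha>\<^sup>2 / 2 * (norm (q (k + 2)))\<^sup>2) / \<delta>
      \<le> (2 * (M * D (k + 2)) + (1 / 2 + 3 * \<alpha>\<^sup>2) * (M * D (k + 1)) + \<alpha>\<^sup>2 / 2 * (M * D k)) / \<delta>"
      using qD[of k] qD[of "k + 1"] qD[of "k + 2"] delta_pos
      by (intro divide_right_mono add_mono mult_left_mono) (simp_all add: eval_nat_numeral)
    finally show "L (u (Suc k + 4)) (v (Suc k + 4)) (p (Suc k + 4))
      \<le> L (u (k + 4)) (v (k + 4)) (p (k + 4)) - (\<nu> / 2 - 2 * M / \<delta>) * D (Suc (Suc k))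
       + ((1 / 2 + 3 * \<alpha>\<^sup>2) * M / \<delta>) * D (Suc k) + (\<alpha>\<^sup>2 / 2 * M / \<delta>) * D k"
      by (simp add: add_divide_distrib left_diff_distrib eval_nat_numeral)
  next
    have "(5 + 7 * \<alpha>\<^sup>2) * M / \<delta> < \<nu>"
      using large delta_pos unfolding M_def[symmetric] by (simp add: pos_divide_less_eq)
    moreover have "(1 / 2 + 3 * \<alpha>\<^sup>2) * M / \<delta> + \<alpha>\<^sup>2 / 2 * M / \<delta> + 2 * M / \<delta>
        = (5 + 7 * \<alpha>\<^sup>2) * M / \<delta> / 2"
      by (simp add: add_divide_distrib algebra_simps)
    ultimately have "(1 / 2 + 3 * \<alpha>\<^sup>2) * M / \<delta> + \<alpha>\<^sup>2 / 2 * M / \<delta> + 2 * M / \<delta> < \<nu> / 2"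
      by simp
    then show "(1 / 2 + 3 * \<alpha>\<^sup>2) * M / \<delta> + \<alpha>\<^sup>2 / 2 * M / \<delta> < \<nu> / 2 - 2 * M / \<delta>"
      by (simp only: less_diff_eq)
  next
    show "\<exists>\<^sub>F k in sequentially. B \<le> L (u (k + 4)) (v (k + 4)) (p (k + 4))"
      unfolding frequently_sequentially
    proof
      fix m
      obtain k where "k \<ge> m + 4" "B \<le> L (u k) (v k) (p k)"
        using bdd unfolding frequently_sequentially by blast
      then show "\<exists>k\<ge>m. B \<le> L (u (k + 4)) (v (k + 4)) (p (k + 4))"
        by (intro exI[of _ "k - 4"]) auto
    qed
  qed (use M0 delta_pos in \<open>auto simp: D_def\<close>)
  then have "(\<lambda>k. sqrt (D k)) \<longlonglongrightarrow> sqrt 0" by (rule tendsto_real_sqrt)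
  then have "(\<lambda>k. u (Suc (k + 2)) - u (k + 2)) \<longlonglongrightarrow> 0"
    by (simp add: D_def tendsto_norm_zero_iff eval_nat_numeral)
  then show "(\<lambda>k. u (Suc k) - u k) \<longlonglongrightarrow> 0"
    by (rule LIMSEQ_offset)
  have "(\<lambda>k. M * D k) \<longlonglongrightarrow> M * 0" using D0 by (rule tendsto_mult_left)
  then have MD: "(\<lambda>k. M * D k) \<longlonglongrightarrow> 0" by simp
  have "(\<lambda>k. (norm (q (k + 2)))\<^sup>2) \<longlonglongrightarrow> 0"
    by (rule tendsto_sandwich[where f = "\<lambda>_. 0", OF _ _ tendsto_const MD]) (use qD in simp_all)
  then have "(\<lambda>k. sqrt ((norm (q (k + 2)))\<^sup>2)) \<longlonglongrightarrow> sqrt 0" by (rule tendsto_real_sqrt)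
  then have "(\<lambda>k. q (k + 2)) \<longlonglongrightarrow> 0" by (simp add: tendsto_norm_zero_iff)
  then show "q \<longlonglongrightarrow> 0" by (rule LIMSEQ_offset)
qed

text \<open>
  The subgradients are taken at the points \<open>(u\<^sup>k, v\<^sup>k\<^sup>+\<^sup>1, ph)\<close> where \<open>v\<^sup>k\<^sup>+\<^sup>1\<close> was computed as a minimiser,
  not at the iterates themselves. Their components are combinations of increments and residuals,
  hence vanish in the limit.
\<close>

lemma cluster_point_critical_if_increments_vanish:
  assumes du: "(\<lambda>k. u (Suc k) - u k) \<longlonglongrightarrow> 0" and q0: "q \<longlonglongrightarrow> 0"
    and r: "strict_mono r"
    and lim: "(\<lambda>j. u (r j)) \<longlonglongrightarrow> u'" "(\<lambda>j. v (r j)) \<longlonglongrightarrow> v'" "(\<lambda>j. p (r j)) \<longlonglongrightarrow> p'"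
  shows "critical_point (\<lambda>(x, y, z). L x y z) (u', v', p')"
proof -
  define R where "R k = T *v u k - v k" for k
  have "(\<lambda>k. (1 / \<delta>) *\<^sub>R (\<alpha> *\<^sub>R q k - q (Suc k))) \<longlonglongrightarrow> (1 / \<delta>) *\<^sub>R (\<alpha> *\<^sub>R 0 - 0)"
    using q0 by (intro tendsto_intros LIMSEQ_Suc)
  then have "(\<lambda>k. R (k + 2)) \<longlonglongrightarrow> 0" by (simp add: R_def residual)
  then have R0: "R \<longlonglongrightarrow> 0" by (rule LIMSEQ_offset)
  have Tdu: "(\<lambda>k. T *v (u (Suc k) - u k)) \<longlonglongrightarrow> 0"
    using bounded_linear.tendsto[OF matrix_vector_mul_bounded_linear du, of T] by simp
  have "(\<lambda>k. T *v (u (Suc k) - u k) - (R (Suc k) - R k)) \<longlonglongrightarrow> 0 - (0 - 0)"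
    by (intro tendsto_diff Tdu R0 LIMSEQ_Suc)
  then have dv: "(\<lambda>k. v (Suc k) - v k) \<longlonglongrightarrow> 0"
    by (simp add: R_def matrix_vector_mult_diff_distrib algebra_simps)
  have dp: "(\<lambda>k. p (Suc k) - p k) \<longlonglongrightarrow> 0" using q0 by (simp add: q_def[abs_def])
  \<comment> \<open>The constraint residual that the \<open>v\<close> update sees, with \<open>u\<close> one index behind.\<close>
  define S where "S k = T *v u (Suc k) - v (Suc (Suc k))" for k
  have "(\<lambda>k. R (Suc (Suc k)) - T *v (u (Suc (Suc k)) - u (Suc k))) \<longlonglongrightarrow> 0 - 0"
    by (intro tendsto_diff LIMSEQ_Suc[OF Tdu] LIMSEQ_Suc R0)
  then have S0: "S \<longlonglongrightarrow> 0"
    by (simp add: R_def S_def[abs_def] matrix_vector_mult_diff_distrib algebra_simps)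
  \<comment> \<open>The \<open>u\<close> component of the subgradient; the multiplier identity turns it into an expression in \<open>q\<close> and \<open>S\<close>.\<close>
  define G where "G k = transpose K *v (K *v u (Suc k) - f) - transpose T *v ph k
      + \<delta> *\<^sub>R (transpose T *v S k)" for k
  have "(\<lambda>k. - \<alpha> *\<^sub>R (transpose T *v q (Suc k)) + \<delta> *\<^sub>R (transpose T *v S (Suc k))) \<longlonglongrightarrow>
      - \<alpha> *\<^sub>R (transpose T *v 0) + \<delta> *\<^sub>R (transpose T *v 0)"
    by (intro tendsto_intros bounded_linear.tendsto[OF matrix_vector_mul_bounded_linear] LIMSEQ_Suc q0 S0)
  moreover have "- \<alpha> *\<^sub>R (transpose T *v q (Suc k)) + \<delta> *\<^sub>R (transpose T *v S (Suc k)) = G (Suc k)" for k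
    unfolding G_def multiplier_identity[symmetric] ph_def
    by (simp add: matrix_vector_right_distrib matrix_vector_mult_scaleR del: transpose_matrix_vector)
  ultimately have "(\<lambda>k. G (Suc k)) \<longlonglongrightarrow> 0" by (simp del: transpose_matrix_vector)
  then have G0: "G \<longlonglongrightarrow> 0" by (rule LIMSEQ_imp_Suc)
  define X where "X j = (u (Suc (r j)), v (Suc (Suc (r j))), ph (r j))" for j
  define \<Xi> where "\<Xi> j = (G (r j), 0 :: real^'d, - S (r j))" for j
  have rlim: "filterlim r sequentially sequentially" by (rule filterlim_subseq[OF r])
  have "X \<longlonglongrightarrow> (u', v', p')"
  proof -
    have "(\<lambda>j. p (r j + 1) + \<alpha> *\<^sub>R q (r j)) \<longlonglongrightarrow> p' + \<alpha> *\<^sub>R 0"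
      by (intro tendsto_intros tendsto_subseq_shift[OF lim(3) r dp] filterlim_compose[OF q0 rlim])
    then show ?thesis
      unfolding X_def ph_def
      using tendsto_subseq_shift[OF lim(1) r du, of 1] tendsto_subseq_shift[OF lim(2) r dv, of 2]
      by (intro tendsto_Pair) simp_all
  qed
  moreover have "\<Xi> \<longlonglongrightarrow> 0"
  proof -
    have "\<Xi> \<longlonglongrightarrow> (0, 0, - 0)"
      unfolding \<Xi>_def
      by (intro tendsto_Pair tendsto_minus tendsto_const filterlim_compose[OF G0 rlim]
          filterlim_compose[OF S0 rlim])
    then show ?thesis by (simp add: zero_prod_def)
  qed
  moreover have "0 \<le> Liminf (at (X j)) (\<lambda>y. ereal (((\<lambda>(x, y, z). L x y z) y - (\<lambda>(x, y, z). L x y z) (X j)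
      - \<Xi> j \<bullet> (y - X j)) / norm (y - X j)))" for j
    unfolding X_def \<Xi>_def G_def S_def
    by (rule aug_lagrangian_regular_subgradient[OF v_argmin]) (use delta_pos in simp)
  ultimately show ?thesis
    unfolding critical_point_def subdifferential_def by blast
qed

text \<open>
  The bounds enter through \<open>\<nu>\<close> and \<open>\<tau>\<close> only, so any matrices with such constants will do; for the
  total variation matrix \<open>\<tau>\<close> is the reciprocal of \<open>\<theta>\<close>.
\<close>

theorem cluster_point_critical:
  assumes "0 \<le> \<sigma>" and "lower_semicontinuous \<phi>"
    and conv: "\<And>x. \<nu> * (norm x)\<^sup>2 \<le> (norm (K *v x))\<^sup>2 + \<delta> * (norm (T *v x))\<^sup>2"
    and adj: "\<And>w. \<tau> * norm w \<le> norm (transpose T *v w)" and \<tau>: "0 < \<tau>"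
    and large: "(5 + 7 * \<alpha>\<^sup>2) * (onorm ((*v) K) ^ 4 / \<tau>\<^sup>2) < \<nu> * \<delta>"
    and cluster: "cluster_point (\<lambda>k. (u k, v k, p k)) (u', v', p')"
  shows "critical_point (\<lambda>(x, y, z). L x y z) (u', v', p')"
proof -
  obtain r where r: "strict_mono r" and "(\<lambda>j. (u (r j), v (r j), p (r j))) \<longlonglongrightarrow> (u', v', p')"
    using cluster by (auto simp: cluster_point_def o_def)
  from tendsto_fst[OF this(2)] tendsto_fst[OF tendsto_snd[OF this(2)]] tendsto_snd[OF tendsto_snd[OF this(2)]]
  have lim: "(\<lambda>j. u (r j)) \<longlonglongrightarrow> u'" "(\<lambda>j. v (r j)) \<longlonglongrightarrow> v'" "(\<lambda>j. p (r j)) \<longlonglongrightarrow> p'"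
    by simp_all
  obtain B where "\<forall>\<^sub>F j in sequentially. B \<le> L (u (r j)) (v (r j)) (p (r j))"
    using aug_lagrangian_eventually_bounded_below[OF assms(2,1) less_imp_le[OF delta_pos] lim] by blast
  then obtain n where n: "\<And>j. j \<ge> n \<Longrightarrow> B \<le> L (u (r j)) (v (r j)) (p (r j))"
    by (auto simp: eventually_sequentially)
  have "\<exists>\<^sub>F k in sequentially. B \<le> L (u k) (v k) (p k)"
    unfolding frequently_sequentially
  proof
    fix m
    have "r (max m n) \<ge> m" using seq_suble[OF r, of "max m n"] by linarith
    then show "\<exists>k\<ge>m. B \<le> L (u k) (v k) (p k)" using n[of "max m n"] by auto
  qed
  from increments_tendsto_zero[OF conv adj \<tau> large this] show ?thesis
    by (rule cluster_point_critical_if_increments_vanish) (rule r lim)+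
qed

end

theorem theorem1:
  fixes N :: nat
    and \<sigma> \<alpha> \<beta> \<delta> \<theta> \<nu> :: real
    and \<phi> :: "real \<Rightarrow> real"
    and Kt :: "real^('n::{finite,linorder} \<times> 'n)^('n \<times> 'n)"
    and ft :: "real^('n \<times> 'n)"
    and K K\<^sub>0 :: "real^('n \<times> 'n + 'n \<times> 'n)^('n \<times> 'n + 'n \<times> 'n)"
    and f :: "real^('n \<times> 'n + 'n \<times> 'n)"
    and T :: "real^('n \<times> 'n + 'n \<times> 'n)^('n \<times> 'm + 'm::{finite,linorder} \<times> 'n)"
    and u :: "nat \<Rightarrow> real^('n \<times> 'n + 'n \<times> 'n)"
    and v p :: "nat \<Rightarrow> real^('n \<times> 'm + 'm \<times> 'n)"
    and u' :: "real^('n \<times> 'n + 'n \<times> 'n)"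
    and v' p' :: "real^('n \<times> 'm + 'm \<times> 'n)"
  assumes "N \<ge> 2" and "CARD('n) = N" and "CARD('m) = N - 1"
    and "\<sigma> > 0" and "\<alpha> > 0" and "\<beta> \<ge> 1"
    and "\<not> convex_on UNIV \<phi>" and "lower_semicontinuous \<phi>"
    and "K = K_matrix \<beta> Kt" and "K\<^sub>0 = K0_matrix Kt" and "T = TV_matrix" and "f = block_vec ft 0"
    and "null_space K\<^sub>0 \<inter> null_space T = {0}"
    and "\<nu> = lambda_min (transpose K\<^sub>0 ** K\<^sub>0 + transpose T ** T)"
    and "\<theta> = 1 / (2 * sin (pi / (2 * real N)))"
    and "\<delta> > max 1 (6 * \<theta>\<^sup>2 * (onorm ((*v) K)) ^ 4 / \<nu> + 7 * \<alpha>\<^sup>2 * \<theta>\<^sup>2 * (onorm ((*v) K)) ^ 4 / \<nu>)"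
    and "IADMM_sequence K f T \<phi> \<sigma> \<alpha> \<delta> u v p"
    and "cluster_point (\<lambda>k. (u k, v k, p k)) (u', v', p')"
  shows "critical_point (\<lambda>(x, y, z). aug_lagrangian K f T \<phi> \<sigma> \<delta> x y z) (u', v', p')"
proof -
  define \<tau> where "\<tau> = 2 * sin (pi / (2 * real N))"
  define M where "M = onorm ((*v) K) ^ 4 / \<tau>\<^sup>2"
  have "pi / (2 * real N) < pi" using \<open>N \<ge> 2\<close> by (simp add: field_simps)
  then have \<tau>: "0 < \<tau>" unfolding \<tau>_def using \<open>N \<ge> 2\<close> by (simp add: sin_gt_zero)
  have \<nu>: "0 < \<nu>" "\<nu> * (norm x)\<^sup>2 \<le> (norm (K\<^sub>0 *v x))\<^sup>2 + (norm (T *v x))\<^sup>2" for x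
    using lambda_min_normal_sum[OF assms(13)] assms(14) by auto
  have \<delta>: "1 < \<delta>" using assms(16) by simp
  interpret inertial_ADMM K f T \<phi> \<sigma> \<alpha> \<delta> u v p
    by unfold_locales (use assms(17) \<delta> in auto)
  show ?thesis
  proof (rule cluster_point_critical)
    fix x
    have "1 * (norm (T *v x))\<^sup>2 \<le> \<delta> * (norm (T *v x))\<^sup>2"
      using \<delta> by (intro mult_right_mono) auto
    with \<nu>(2)[of x] norm_K0_le_norm_K[OF \<open>\<beta> \<ge> 1\<close>, of Kt x]
    show "\<nu> * (norm x)\<^sup>2 \<le> (norm (K *v x))\<^sup>2 + \<delta> * (norm (T *v x))\<^sup>2"
      unfolding assms(9,10) by linarith
  next
    fix w
    have "CARD('n) = CARD('m) + 1" using assms(1-3) by simp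
    from TV_matrix_adjoint_bound[OF this, of w]
    show "\<tau> * norm w \<le> norm (transpose T *v w)"
      unfolding \<tau>_def \<open>T = TV_matrix\<close> \<open>CARD('n) = N\<close> .
  next
    have "0 \<le> M" by (simp add: M_def)
    have "\<theta>\<^sup>2 * onorm ((*v) K) ^ 4 = M"
      unfolding M_def assms(15) \<tau>_def[symmetric] by (simp add: power_divide)
    moreover have "(6 * (\<theta>\<^sup>2 * onorm ((*v) K) ^ 4) + 7 * \<alpha>\<^sup>2 * (\<theta>\<^sup>2 * onorm ((*v) K) ^ 4)) / \<nu> < \<delta>"
      using assms(16) by (simp add: add_divide_distrib mult.assoc)
    ultimately have "6 * M + 7 * \<alpha>\<^sup>2 * M < \<delta> * \<nu>"
      using \<nu>(1) by (simp add: divide_less_eq)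
    with \<open>0 \<le> M\<close> show "(5 + 7 * \<alpha>\<^sup>2) * (onorm ((*v) K) ^ 4 / \<tau>\<^sup>2) < \<nu> * \<delta>"
      unfolding M_def[symmetric] by (simp add: algebra_simps)
  qed (use assms \<tau> in auto)
qed

end
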